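(* For all positive integers $n$ and $r$ and every $q$, $$\sum_{k=0}^n H_k^{(r)}\binom{n}{k}(1-q)^k q^{n-k} = H_n^{(r)} - \sum_{j=1}^n\left(\sum_{l=0}^{j-1}(-1)^{j-l-1}\binom{n-l-1}{n-j}\binom{n}{l}\frac{1}{(n-l)^{r-1}}\right)\frac{q^j}{j}.$$
   Context: For integers $k\ge 0$ and $r\ge 1$, $H_k^{(r)}=\sum_{i=1}^k \frac{1}{i^r}$ is the $k$-th harmonic number of order $r$ (so $H_0^{(r)}=0$). *)

theory Defs
  imports Complex_Main
begin

definition harm_ord :: "nat \<Rightarrow> nat \<Rightarrow> 'a :: field_char_0" where
  "harm_ord r k = (\<Sum>i=1..k. 1 / of_nat i ^ r)"

end

theory Submission
  imports Defs
begin

text \<open>Exchanging summations, the left-hand side is the sum of the weights \<open>1 / m ^ r\<close> times the upper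
  binomial tails \<open>\<Sum>k\<ge>m\<close>, and each upper tail is \<open>1\<close> minus a lower tail. The lower tail
  is expanded in powers of \<open>q\<close> by induction on its length; the summation indices on the right-hand side
  are then \<open>l = n - m\<close> and \<open>j = n - t\<close>.\<close>

text \<open>Indexing the binomial expansion by the number \<open>t\<close> of factors contributing
  \<open>1\<close> makes the exponent \<open>(m - t) + (n - m) = n - t\<close> independent of
  \<open>m\<close>, so coefficients for different \<open>m\<close> can be compared.\<close>

lemma one_minus_power_times_power:
  fixes q :: "'a :: comm_ring_1"
  assumes "m \<le> n"
  shows "(1 - q) ^ m * q ^ (n - m) = (\<Sum>t\<le>m. (- 1) ^ (m - t) * of_nat (m choose t) * q ^ (n - t))"
proof -
  have "(1 - q) ^ m * q ^ (n - m) = (\<Sum>t\<le>m. of_nat (m choose t) * (- q) ^ (m - t)) * q ^ (n - m)"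
    using binomial_ring[of 1 "- q" m] by simp
  also have "\<dots> = (\<Sum>t\<le>m. (- 1) ^ (m - t) * of_nat (m choose t) * q ^ (n - t))"
    unfolding sum_distrib_right
  proof (rule sum.cong[OF refl])
    fix t assume "t \<in> {..m}"
    then have "q ^ (n - t) = q ^ (m - t) * q ^ (n - m)"
      using assms by (simp flip: power_add)
    then show "of_nat (m choose t) * (- q) ^ (m - t) * q ^ (n - m) =
        (- 1) ^ (m - t) * of_nat (m choose t) * q ^ (n - t)"
      by (subst power_minus) (simp add: mult_ac)
  qed
  finally show ?thesis .
qed

text \<open>The right-hand side is the incomplete beta integral of
  \<open>m * (n choose m) * x ^ (n - m) * (1 - x) ^ (m - 1)\<close> from \<open>0\<close> to
  \<open>q\<close>, integrated term by term. The induction on \<open>m\<close> replaces integration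
  by parts, so any field of characteristic 0 will do.\<close>

lemma lower_binomial_tail:
  fixes q :: "'a :: field_char_0"
  assumes "m \<le> n"
  shows "(\<Sum>k<m. of_nat (n choose k) * (1 - q) ^ k * q ^ (n - k)) =
    of_nat (n choose m) * of_nat m *
      (\<Sum>t<m. (- 1) ^ (m - Suc t) * of_nat (m - 1 choose t) * (q ^ (n - t) / of_nat (n - t)))"
  using assms
proof (induction m)
  case (Suc m)
  \<comment> \<open>This rewrites the prefactor of the goal so that it shares
    \<open>n choose m\<close> with the induction hypothesis and with the new summand
    \<open>k = m\<close>.\<close>
  have choose_Suc: "of_nat (n choose Suc m) * of_nat (Suc m) = of_nat (n choose m) * (of_nat (n - m) :: 'a)"
    using binomial_absorb_comp[of n m] binomial_absorption[of m n]
    by (metis mult.commute of_nat_mult)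
  have choose_pred: "m * (m - 1 choose t) = (m - t) * (m choose t)" for t
    using binomial_absorb_comp[of m t] by simp
  \<comment> \<open>Split \<open>n - t = (n - m) + (m - t)\<close>: by \<open>choose_pred\<close>
    the \<open>m - t\<close> part cancels the first summand, whose sign is opposite.\<close>
  have coeff: "of_nat m * of_nat (m - 1 choose t) * (- 1) ^ (m - Suc t) * x
      + (- 1) ^ (m - t) * of_nat (m choose t) * (of_nat (n - t) * x)
      = of_nat (n - m) * ((- 1) ^ (m - t) * of_nat (m choose t) * x)"
    if "t < m" for t and x :: 'a
  proof -
    have "of_nat m * of_nat (m - 1 choose t) = (of_nat (m - t) * of_nat (m choose t) :: 'a)"
      by (simp only: choose_pred flip: of_nat_mult)
    moreover have "(- 1) ^ (m - t) = - ((- 1) ^ (m - Suc t) :: 'a)"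
      using that by (metis Suc_diff_Suc mult_minus1 power_Suc)
    moreover have "of_nat (n - t) = of_nat (n - m) + (of_nat (m - t) :: 'a)"
      using that Suc.prems by (simp flip: of_nat_add)
    ultimately show ?thesis by (simp add: algebra_simps)
  qed
  let ?x = "\<lambda>t. q ^ (n - t) / (of_nat (n - t) :: 'a)"
  have "(1 - q) ^ m * q ^ (n - m) = (\<Sum>t<Suc m. (- 1) ^ (m - t) * of_nat (m choose t) * q ^ (n - t))"
    using Suc.prems by (simp only: one_minus_power_times_power Suc_leD lessThan_Suc_atMost)
  \<comment> \<open>The denominators are nonzero because \<open>t \<le> m < n\<close>.\<close>
  also have "\<dots> = (\<Sum>t<Suc m. (- 1) ^ (m - t) * of_nat (m choose t) * (of_nat (n - t) * ?x t))"
    using Suc.prems by (intro sum.cong) auto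
  also have "\<dots> = (\<Sum>t<m. (- 1) ^ (m - t) * of_nat (m choose t) * (of_nat (n - t) * ?x t))
      + of_nat (n - m) * ?x m"
    by simp
  finally have "of_nat m * (\<Sum>t<m. (- 1) ^ (m - Suc t) * of_nat (m - 1 choose t) * ?x t)
        + (1 - q) ^ m * q ^ (n - m)
      = (\<Sum>t<m. of_nat m * of_nat (m - 1 choose t) * (- 1) ^ (m - Suc t) * ?x t
          + (- 1) ^ (m - t) * of_nat (m choose t) * (of_nat (n - t) * ?x t)) + of_nat (n - m) * ?x m"
    by (simp only: sum.distrib sum_distrib_left ac_simps)
  also have "\<dots> = (\<Sum>t<m. of_nat (n - m) * ((- 1) ^ (m - t) * of_nat (m choose t) * ?x t))
      + of_nat (n - m) * ?x m"
    by (intro arg_cong2[where f = "(+)"] sum.cong refl coeff) simp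
  also have "\<dots> = of_nat (n - m) * (\<Sum>t<Suc m. (- 1) ^ (m - t) * of_nat (m choose t) * ?x t)"
    by (simp add: sum_distrib_left distrib_left)
  finally have step: "of_nat m * (\<Sum>t<m. (- 1) ^ (m - Suc t) * of_nat (m - 1 choose t) * ?x t)
      + (1 - q) ^ m * q ^ (n - m)
      = of_nat (n - m) * (\<Sum>t<Suc m. (- 1) ^ (m - t) * of_nat (m choose t) * ?x t)" .
  have "(\<Sum>k<Suc m. of_nat (n choose k) * (1 - q) ^ k * q ^ (n - k)) =
      of_nat (n choose m) * (of_nat m * (\<Sum>t<m. (- 1) ^ (m - Suc t) * of_nat (m - 1 choose t) * ?x t)
        + (1 - q) ^ m * q ^ (n - m))"
    using Suc by (simp add: distrib_left mult.assoc)
  also have "\<dots> = of_nat (n choose Suc m) * of_nat (Suc m) *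
      (\<Sum>t<Suc m. (- 1) ^ (m - t) * of_nat (m choose t) * ?x t)"
    unfolding step choose_Suc by (simp only: mult.assoc)
  finally show ?case by simp
qed simp

theorem theorem2:
  fixes q :: "'a :: field_char_0" and n r :: nat
  assumes "n \<ge> 1" and "r \<ge> 1"
  shows "(\<Sum>k=0..n. harm_ord r k * of_nat (n choose k) * (1 - q) ^ k * q ^ (n - k)) =
    harm_ord r n -
    (\<Sum>j=1..n.
      (\<Sum>l=0..j-1. (- 1) ^ (j - l - 1) * of_nat ((n - l - 1) choose (n - j)) * of_nat (n choose l)
                     * (1 / of_nat (n - l) ^ (r - 1)))
      * (q ^ j / of_nat j))"
proof -
  let ?B = "\<lambda>k. of_nat (n choose k) * (1 - q) ^ k * q ^ (n - k)"
  let ?F = "\<lambda>m t. (- 1) ^ (m - Suc t) * of_nat (m - 1 choose t) * of_nat (n choose m)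
    * (1 / of_nat m ^ (r - 1)) * (q ^ (n - t) / of_nat (n - t))"
  let ?G = "\<lambda>j l. (- 1) ^ (j - l - 1) * of_nat ((n - l - 1) choose (n - j)) * of_nat (n choose l)
    * (1 / of_nat (n - l) ^ (r - 1)) * (q ^ j / of_nat j)"
  have total: "(\<Sum>k\<le>n. ?B k) = 1"
    using binomial_ring[of "1 - q" q n] by simp
  have upper: "(\<Sum>k=m..n. ?B k) = 1 - (\<Sum>k<m. ?B k)" if "m \<le> n" for m
  proof -
    have "{..n} = {..<m} \<union> {m..n}" using that by auto
    then have "(\<Sum>k\<le>n. ?B k) = (\<Sum>k<m. ?B k) + (\<Sum>k=m..n. ?B k)"
      by (simp add: sum.union_disjoint ivl_disj_int)
    then show ?thesis using total by (simp add: algebra_simps)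
  qed
  \<comment> \<open>The factor \<open>m\<close> in front of the tail expansion cancels one power of
    \<open>m\<close> in the weight; hence the exponent \<open>r - 1\<close>.\<close>
  have weighted: "1 / of_nat m ^ r * (\<Sum>k<m. ?B k) = (\<Sum>t<m. ?F m t)" if "m \<in> {1..n}" for m
  proof -
    have "of_nat m ^ r = of_nat m * (of_nat m ^ (r - 1) :: 'a)"
      using assms(2) by (cases r) auto
    then have "1 / of_nat m ^ r * (of_nat (n choose m) * of_nat m * S) =
        of_nat (n choose m) * (1 / of_nat m ^ (r - 1)) * S" for S :: 'a
      using that by simp
    moreover have "(\<Sum>k<m. ?B k) = of_nat (n choose m) * of_nat m *
        (\<Sum>t<m. (- 1) ^ (m - Suc t) * of_nat (m - 1 choose t) * (q ^ (n - t) / of_nat (n - t)))"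
      using that by (intro lower_binomial_tail) simp
    ultimately have "1 / of_nat m ^ r * (\<Sum>k<m. ?B k) = of_nat (n choose m) * (1 / of_nat m ^ (r - 1)) *
        (\<Sum>t<m. (- 1) ^ (m - Suc t) * of_nat (m - 1 choose t) * (q ^ (n - t) / of_nat (n - t)))"
      by (simp only:)
    then show ?thesis
      by (simp only: sum_distrib_left mult_ac)
  qed
  have "(\<Sum>k=0..n. harm_ord r k * of_nat (n choose k) * (1 - q) ^ k * q ^ (n - k))
      = (\<Sum>k=0..n. \<Sum>m=1..k. 1 / of_nat m ^ r * ?B k)"
    unfolding harm_ord_def by (simp only: sum_distrib_right mult.assoc)
  \<comment> \<open>Both sides run over \<open>1 \<le> m \<le> k \<le> n\<close>, since
    \<open>k = 0\<close> has an empty inner sum.\<close>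
  also have "\<dots> = (\<Sum>m=1..n. \<Sum>k=m..n. 1 / of_nat m ^ r * ?B k)"
    unfolding sum.Sigma[OF finite_atLeastAtMost ballI[OF finite_atLeastAtMost]]
    by (rule sum.reindex_bij_witness[where i = prod.swap and j = prod.swap]) auto
  also have "\<dots> = (\<Sum>m=1..n. 1 / of_nat m ^ r - (\<Sum>t<m. ?F m t))"
  proof (rule sum.cong[OF refl])
    fix m assume m: "m \<in> {1..n}"
    then have "(\<Sum>k=m..n. 1 / of_nat m ^ r * ?B k) = 1 / of_nat m ^ r * (1 - (\<Sum>k<m. ?B k))"
      by (simp only: upper atLeastAtMost_iff flip: sum_distrib_left)
    also have "\<dots> = 1 / of_nat m ^ r - (\<Sum>t<m. ?F m t)"
      by (simp only: right_diff_distrib weighted[OF m] mult_1_right)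
    finally show "(\<Sum>k=m..n. 1 / of_nat m ^ r * ?B k) = 1 / of_nat m ^ r - (\<Sum>t<m. ?F m t)" .
  qed
  also have "\<dots> = harm_ord r n - (\<Sum>m=1..n. \<Sum>t<m. ?F m t)"
    by (simp only: sum_subtractf harm_ord_def)
  also have "(\<Sum>m=1..n. \<Sum>t<m. ?F m t) = (\<Sum>j=1..n. \<Sum>l=0..j-1. ?G j l)"
    unfolding sum.Sigma[OF finite_atLeastAtMost ballI[OF finite_atLeastAtMost]]
      sum.Sigma[OF finite_atLeastAtMost ballI[OF finite_lessThan]]
    \<comment> \<open>The substitution reverses both coordinates and swaps them, so
      \<open>t < m\<close> becomes \<open>l \<le> j - 1\<close> and \<open>m - Suc t\<close> becomes
      \<open>j - l - 1\<close>. Symmetry turns \<open>n choose m\<close> into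
      \<open>n choose l\<close>.\<close>
    by (rule sum.reindex_bij_witness[where i = "\<lambda>(j, l). (n - l, n - j)" and j = "\<lambda>(m, t). (n - t, n - m)"])
      (auto simp flip: binomial_symmetric)
  finally show ?thesis by (simp only: sum_distrib_right)
qed

end
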